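(* $E_1$ is in the spectrum of $\mathcal{I}(\mathcal{E}_\infty)$. More precisely, there exists a Borel equivalence relation $F$ on $\mathcal{E}_\infty$ such that for every $m\in\mathbb{N}$ and every $B\in\mathcal{E}_\infty$ the restriction $F\upharpoonright [m,B]_\infty$ is Borel bireducible with $E_1$.
   Context: $\mathcal{E}_\infty$ is the set of all equivalence relations on $\mathbb{N}=\{0,1,2,\ldots\}$ with infinitely many classes. For $A,B\in\mathcal{E}_\infty$ write $A\le B$ if every $A$-class is a union of $B$-classes. $\mathcal{E}_\infty$ carries the Polish topology inherited from $2^{\mathbb{N}\times\mathbb{N}}$ (viewing an equivalence relation as a subset of $\mathbb{N}\times\mathbb{N}$; equivalently, generated by the sets $\{A: A\upharpoonright k = s\}$ with $k=\min$ of some $A$-class), and "Borel" refers to this topology. For $m\in\mathbb{N}$ and $B\in\mathcal{E}_\infty$, $[m,B]_\infty$ is the set of all $A\in\mathcal{E}_\infty$ with $A\le B$ such that $A$ and $B$ have the same restriction to $\{0,\ldots,m-1\}$. $\mathcal{I}(\mathcal{E}_\infty)$ is the $\sigma$-ideal of all $\mathcal{X}\subseteq\mathcal{E}_\infty$ such that for every $B\in\mathcal{E}_\infty$ and $m\in\mathbb{N}$ there is $B'\in[m,B]_\infty$ with $[m,B']_\infty\cap\mathcal{X}=\emptyset$. $E_1$ is the equivalence relation on $2^{\mathbb{N}\times\mathbb{N}}$ given by $x\,E_1\,y$ iff there is $n_0\in\mathbb{N}$ such that $x(n_0+n,m)=y(n_0+n,m)$ for all $n,m\in\mathbb{N}$.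 For equivalence relations $E$ on $X$ and $F$ on $Y$ ($X,Y$ standard Borel), $E\le_B F$ means there is a Borel map $f:X\to Y$ with $x\,E\,x'\iff f(x)\,F\,f(x')$ for all $x,x'\in X$; $E$ and $F$ are Borel bireducible if $E\le_B F$ and $F\le_B E$. An analytic equivalence relation $F$ on a Polish space $X$ is in the spectrum of a $\sigma$-ideal $\mathcal{I}$ on $X$ if for every Borel $\mathcal{B}\subseteq X$ with $\mathcal{B}\notin\mathcal{I}$ there is a Borel $\mathcal{C}\subseteq\mathcal{B}$ with $\mathcal{C}\notin\mathcal{I}$ such that $F$ and $F\upharpoonright\mathcal{C}$ are Borel bireducible. Saying that $E_1$ (which lives on $2^{\mathbb{N}\times\mathbb{N}}$) is in the spectrum of $\mathcal{I}(\mathcal{E}_\infty)$ means that some equivalence relation on $\mathcal{E}_\infty$ that is Borel bireducible with $E_1$ is in the spectrum of $\mathcal{I}(\mathcal{E}_\infty)$. *)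

theory Defs
  imports "HOL-Analysis.Analysis"
begin

text \<open>
  The space \<open>2^(N x N)\<close> is the type \<open>nat \<times> nat \<Rightarrow> bool\<close> with its product topology. A point \<open>A\<close> of
  it is the characteristic function of the binary relation \<open>Collect A\<close> on \<open>nat\<close>. Equivalence
  relations on a space \<open>X\<close> of such points are sets of pairs, \<open>F \<subseteq> X \<times> X\<close>, as in the predicate
  \<open>equiv\<close>. The Borel structure of a subspace \<open>X\<close> is \<open>restrict_space borel X\<close>.
\<close>

abbreviation classes :: "(nat \<times> nat \<Rightarrow> bool) \<Rightarrow> nat set set" where
  "classes A \<equiv> UNIV // Collect A"

definition E_infty :: "(nat \<times> nat \<Rightarrow> bool) set" where
  "E_infty = {A. equiv UNIV (Collect A) \<and> infinite (classes A)}"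

text \<open>
  \<open>coarser A B\<close> is the order usually written \<open>A \<le> B\<close>, and \<open>cube m B\<close> is the basic
  dual Ellentuck set \<open>[m, B]\<close>.
\<close>

definition coarser :: "(nat \<times> nat \<Rightarrow> bool) \<Rightarrow> (nat \<times> nat \<Rightarrow> bool) \<Rightarrow> bool" where
  "coarser A B \<longleftrightarrow> (\<forall>C \<in> classes A. \<exists>S \<subseteq> classes B. C = \<Union>S)"

definition cube :: "nat \<Rightarrow> (nat \<times> nat \<Rightarrow> bool) \<Rightarrow> (nat \<times> nat \<Rightarrow> bool) set" where
  "cube m B = {A \<in> E_infty. coarser A B \<and> Restr (Collect A) {..<m} = Restr (Collect B) {..<m}}"

definition I_infty :: "(nat \<times> nat \<Rightarrow> bool) set set" where
  "I_infty = {X. X \<subseteq> E_infty \<and> (\<forall>B \<in> E_infty. \<forall>m. \<exists>B' \<in> cube m B. cube m B' \<inter> X = {})}"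

definition E1 :: "(nat \<times> nat \<Rightarrow> bool) rel" where
  "E1 = {(x, y). \<exists>n0. \<forall>n m. x (n0 + n, m) = y (n0 + n, m)}"

definition borel_reducible ::
  "'a::topological_space set \<Rightarrow> 'a rel \<Rightarrow> 'b::topological_space set \<Rightarrow> 'b rel \<Rightarrow> bool" where
  "borel_reducible X E Y F \<longleftrightarrow>
    (\<exists>f \<in> restrict_space borel X \<rightarrow>\<^sub>M restrict_space borel Y.
      \<forall>x \<in> X. \<forall>x' \<in> X. (x, x') \<in> E \<longleftrightarrow> (f x, f x') \<in> F)"

definition borel_bireducible ::
  "'a::topological_space set \<Rightarrow> 'a rel \<Rightarrow> 'b::topological_space set \<Rightarrow> 'b rel \<Rightarrow> bool" where
  "borel_bireducible X E Y F \<longleftrightarrow> borel_reducible X E Y F \<and> borel_reducible Y F X E"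

definition borel_equiv :: "'a::topological_space set \<Rightarrow> 'a rel \<Rightarrow> bool" where
  "borel_equiv X F \<longleftrightarrow> equiv X F \<and> F \<in> sets (restrict_space borel (X \<times> X))"

text \<open>
  Analytic sets are the projections along the Baire space \<open>nat \<Rightarrow> nat\<close> of Borel sets. For a Borel
  subspace \<open>X\<close>, it does not matter whether a subset of \<open>X\<close> is called analytic in \<open>X\<close> or in the
  ambient space.
\<close>

definition analytic_set :: "'a::topological_space set \<Rightarrow> bool" where
  "analytic_set S \<longleftrightarrow> (\<exists>P \<in> sets (borel :: ('a \<times> (nat \<Rightarrow> nat)) measure). S = fst ` P)"

definition in_spectrum :: "'a::topological_space set \<Rightarrow> 'a set set \<Rightarrow> 'a rel \<Rightarrow> bool" where
  "in_spectrum X I F \<longleftrightarrow> equiv X F \<and> analytic_set F \<and>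
    (\<forall>B \<in> sets (restrict_space borel X). B \<notin> I \<longrightarrow>
      (\<exists>C \<in> sets (restrict_space borel X). C \<subseteq> B \<and> C \<notin> I \<and> borel_bireducible X F C (Restr F C)))"

text \<open>
  An equivalence relation \<open>E\<close> living on another space \<open>Y\<close> is said to be in the spectrum of an ideal
  on \<open>X\<close> if some relation on \<open>X\<close> that is Borel bireducible with \<open>E\<close> is.
\<close>

definition in_spectrum_up_to_bireducibility ::
  "'a::topological_space set \<Rightarrow> 'a set set \<Rightarrow> 'b::topological_space set \<Rightarrow> 'b rel \<Rightarrow> bool" where
  "in_spectrum_up_to_bireducibility X I Y E \<longleftrightarrow>
    (\<exists>F. in_spectrum X I F \<and> borel_bireducible X F Y E)"

end

theory Submission
  imports Defs
begin

text \<open>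
  The relation \<open>F\<close> is the pullback of \<open>E1\<close> under a map that depends only on the set of class
  minima of \<open>A\<close>: column \<open>n\<close> of the image records the minima whose index in the increasing
  enumeration has the form \<open>prod_encode (n, l)\<close>. What has to be shown is that \<open>E1\<close> reduces to
  \<open>F\<close> restricted to \<open>X\<close> for every Borel \<open>X\<close> outside the ideal. No partition theorem for
  \<open>E_infty\<close> is needed for this. If \<open>X\<close> meets every \<open>[m, B']\<close> with \<open>B' \<in> [m, B]\<close>, take a nonprincipal
  ultrafilter containing the set of minima of \<open>B\<close>. Whatever sets of the ultrafilter
  are prescribed for the successive minima above \<open>m\<close>, as functions of the earlier minima, some
  member of \<open>X\<close> complies: merge all classes of \<open>B\<close> outside a sufficiently sparse set of minima into the
  class of \<open>0\<close>. Writing \<open>X\<close> as the projection of a closed set, a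
  strategy argument turns this into a continuous choice of members of \<open>X\<close> for all sequences of
  minima that follow one fixed prescription. Because finitely many sets of an ultrafilter
  intersect, the prescription allows at stage \<open>k\<close> two values that do not depend on the previous
  choices, and choosing between them according to the bits of \<open>z\<close> reduces \<open>E1\<close> to \<open>F\<close> on \<open>X\<close>.
\<close>

section \<open>Ultrafilters and prescriptions\<close>

text \<open>Zorn's lemma for the proper filters below \<open>F\<close>, finer filters counting as
  larger: the infimum of a chain is proper because its members form a base. If a maximally fine
  \<open>U\<close> does not exclude \<open>P\<close>, restricting it to \<open>P\<close> leaves a
  proper filter, which must be \<open>U\<close> itself.\<close>

lemma ex_ultrafilter_le:
  assumes "F \<noteq> (bot :: 'a filter)"
  obtains U where "U \<le> F" "U \<noteq> bot"
    "\<And>P. eventually P U \<or> eventually (\<lambda>x. \<not> P x) U"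
proof -
  define \<A> where "\<A> = {G. G \<le> F \<and> G \<noteq> bot}"
  have "partial_order_on \<A> (relation_of (\<ge>) \<A>)"
    by (auto intro!: partial_order_on_relation_ofI)
  moreover have "\<exists>u\<in>\<A>. \<forall>a\<in>C. u \<le> a" if C: "C \<in> Chains (relation_of (\<ge>) \<A>)" for C
  proof (cases "C = {}")
    case True
    then show ?thesis using assms by (auto simp: \<A>_def)
  next
    case False
    have CA: "C \<subseteq> \<A>" and lin: "\<And>a b. a \<in> C \<Longrightarrow> b \<in> C \<Longrightarrow> a \<le> b \<or> b \<le> a"
      using C by (auto simp: Chains_def relation_of_def)
    have "eventually (\<lambda>_. False) (Inf C) \<longleftrightarrow> (\<exists>b\<in>C. eventually (\<lambda>_. False) b)"
    proof (rule eventually_Inf_base)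
      show "C \<noteq> {}" by fact
      show "\<exists>x\<in>C. x \<le> inf a b" if "a \<in> C" "b \<in> C" for a b
        using lin[OF that] that by (metis inf.absorb1 inf.absorb2 order_refl)
    qed
    then have "Inf C \<noteq> bot"
      using CA by (auto simp: \<A>_def trivial_limit_def)
    moreover have "Inf C \<le> F"
      using False CA by (auto simp: \<A>_def intro: Inf_lower2)
    ultimately show ?thesis
      by (auto simp: \<A>_def intro: Inf_lower)
  qed
  ultimately obtain U where U: "U \<in> \<A>" and max: "\<And>G. G \<in> \<A> \<Longrightarrow> G \<le> U \<Longrightarrow> G = U"
    using predicate_Zorn[of \<A> "(\<ge>)"] by blast
  have "eventually P U \<or> eventually (\<lambda>x. \<not> P x) U" for P
  proof (rule disjCI)
    assume "\<not> eventually (\<lambda>x. \<not> P x) U"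
    then have "inf U (principal {x. P x}) \<in> \<A>"
      using U by (auto simp: \<A>_def trivial_limit_def eventually_inf_principal intro: le_infI1)
    then have "inf U (principal {x. P x}) = U"
      by (intro max) auto
    moreover have "eventually P (inf U (principal {x. P x}))"
      by (simp add: eventually_inf_principal)
    ultimately show "eventually P U" by simp
  qed
  then show thesis using that U by (auto simp: \<A>_def)
qed

text \<open>Histories are stored with the most recent entry first.\<close>

primrec hist :: "(nat \<Rightarrow> 'a) \<Rightarrow> nat \<Rightarrow> 'a list" where
  "hist x 0 = []"
| "hist x (Suc k) = x k # hist x k"

lemma length_hist [simp]: "length (hist x k) = k"
  by (induction k) auto

lemma set_hist: "set (hist x k) = x ` {..<k}"
  by (induction k) (auto simp: lessThan_Suc)

lemma drop_hist: "k \<le> n \<Longrightarrow> drop (n - k) (hist x n) = hist x k"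
  by (induction n) (auto simp: Suc_diff_le le_Suc_eq)

lemma rev_hist: "rev (hist x k) = map x [0..<k]"
  by (induction k) auto

lemma hist_eq_iff: "hist x k = hist y k \<longleftrightarrow> (\<forall>i<k. x i = y i)"
  by (induction k) (auto simp: less_Suc_eq)

definition obeys :: "(nat list \<Rightarrow> nat \<Rightarrow> bool) \<Rightarrow> nat \<Rightarrow> (nat \<Rightarrow> nat) \<Rightarrow> bool" where
  "obeys \<phi> k x \<longleftrightarrow> (\<forall>n\<ge>k. \<phi> (hist x n) (x n))"

definition strategy :: "nat filter \<Rightarrow> (nat list \<Rightarrow> nat \<Rightarrow> bool) \<Rightarrow> bool" where
  "strategy U \<phi> \<longleftrightarrow> (\<forall>t. eventually (\<phi> t) U)"

text \<open>
  In \<open>(x, w) \<in> Z\<close>, \<open>x\<close> is the sequence of minima and \<open>w\<close> a code for the remaining data; \<open>t\<close> and \<open>u\<close>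
  are histories of the two.
\<close>

definition positive ::
  "nat filter \<Rightarrow> ((nat \<Rightarrow> nat) \<times> (nat \<Rightarrow> nat)) set \<Rightarrow> nat list \<Rightarrow> nat list \<Rightarrow> bool" where
  "positive U Z t u \<longleftrightarrow> (\<forall>\<phi>. strategy U \<phi> \<longrightarrow>
    (\<exists>(x, w)\<in>Z. hist x (length t) = t \<and> hist w (length u) = u \<and> obeys \<phi> (length t) x))"

definition improves ::
  "nat filter \<Rightarrow> ((nat \<Rightarrow> nat) \<times> (nat \<Rightarrow> nat)) set \<Rightarrow> nat list \<Rightarrow> nat list \<Rightarrow> bool" where
  "improves U Z t u \<longleftrightarrow> (\<exists>i. positive U Z t (i # u))"

text \<open>
  The unfolded game, in which entries of \<open>w\<close> are also played, is open for the player who extends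
  \<open>u\<close>. If that player had no winning strategy, the ultrafilter would provide a prescription
  \<open>\<phi>0\<close> avoiding all improvements; intersecting it with prescriptions that refute each
  \<open>positive U Z s (i # u)\<close> yields one that refutes \<open>positive U Z t u\<close>. At \<open>t''\<close> only the finitely many
  \<open>i \<le> length t''\<close> are treated, which suffices since \<open>i\<close> is fixed along a sequence.
\<close>

lemma positive_imp_strategy_improves:
  assumes ultra: "\<And>P. eventually P U \<or> eventually (\<lambda>n. \<not> P n) U"
    and pos: "positive U Z t u"
  shows "\<exists>\<psi>. strategy U \<psi> \<and> (\<forall>x. hist x (length t) = t \<longrightarrow> obeys \<psi> (length t) x \<longrightarrow>
    (\<exists>k>length t. improves U Z (hist x k) u))"
proof -
  \<comment> \<open>Winning histories for the player who extends \<open>u\<close>, who needs a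
    single prescription \<open>\<psi>\<close>. The goal is \<open>D t\<close>.\<close>
  define D where "D s \<longleftrightarrow> (\<exists>\<psi>. strategy U \<psi> \<and> (\<forall>x. hist x (length s) = s \<longrightarrow>
    obeys \<psi> (length s) x \<longrightarrow> (\<exists>k>length s. improves U Z (hist x k) u)))" for s
  have not_D: "eventually (\<lambda>n. \<not> D (n # s) \<and> \<not> improves U Z (n # s) u) U" if "\<not> D s" for s
  proof (rule ccontr)
    assume "\<not> ?thesis"
    then have ev: "eventually (\<lambda>n. D (n # s) \<or> improves U Z (n # s) u) U"
      using ultra[of "\<lambda>n. \<not> D (n # s) \<and> \<not> improves U Z (n # s) u"] by simp
    have "\<exists>\<psi>. strategy U \<psi> \<and> (D (n # s) \<longrightarrow> (\<forall>x. hist x (length (n # s)) = n # s \<longrightarrow>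
        obeys \<psi> (length (n # s)) x \<longrightarrow> (\<exists>k>length (n # s). improves U Z (hist x k) u)))" for n
    proof (cases "D (n # s)")
      case True
      then show ?thesis unfolding D_def[of "n # s"] by blast
    next
      case False
      then show ?thesis by (intro exI[of _ "\<lambda>_ _. True"]) (auto simp: strategy_def)
    qed
    then obtain \<psi> where \<psi>: "\<And>n. strategy U (\<psi> n)"
      "\<And>n x. D (n # s) \<Longrightarrow> hist x (length (n # s)) = n # s \<Longrightarrow> obeys (\<psi> n) (length (n # s)) x \<Longrightarrow>
        \<exists>k>length (n # s). improves U Z (hist x k) u"
      by metis
    \<comment> \<open>Glues the prescriptions \<open>\<psi> n\<close>: at \<open>s\<close> only a
      good successor is required; afterwards the prescription for the successor actually chosen is
      followed. That successor is recovered as \<open>rev t' ! length s\<close>, since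
      \<open>rev\<close> restores chronological order.\<close>
    define \<xi> where "\<xi> t' = (if t' = s then (\<lambda>n. D (n # s) \<or> improves U Z (n # s) u)
      else \<psi> (rev t' ! length s) t')" for t'
    have "strategy U \<xi>"
      using ev \<psi>(1) by (auto simp: strategy_def \<xi>_def)
    moreover have "\<exists>k>length s. improves U Z (hist x k) u"
      if x: "hist x (length s) = s" and ob: "obeys \<xi> (length s) x" for x
    proof -
      let ?l = "length s"
      have hl: "hist x (Suc ?l) = x ?l # s" using x by simp
      have "D (x ?l # s) \<or> improves U Z (x ?l # s) u"
        using ob x by (auto simp: obeys_def \<xi>_def dest!: spec[of _ ?l])
      then show ?thesis
      proof
        assume "D (x ?l # s)"
        moreover have "obeys (\<psi> (x ?l)) (length (x ?l # s)) x"
          unfolding obeys_def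
        proof (intro allI impI)
          fix n assume n: "length (x ?l # s) \<le> n"
          then have "hist x n \<noteq> s" using length_hist[of x n] by auto
          moreover have "rev (hist x n) ! ?l = x ?l" using n by (simp add: rev_hist)
          moreover have "\<xi> (hist x n) (x n)" using ob n unfolding obeys_def by simp
          ultimately show "\<psi> (x ?l) (hist x n) (x n)" unfolding \<xi>_def by simp
        qed
        ultimately show ?thesis using \<psi>(2)[of "x ?l" x] hl by (auto intro: Suc_lessD)
      next
        assume "improves U Z (x ?l # s) u"
        then show ?thesis using hl by (metis lessI)
      qed
    qed
    ultimately have "D s" unfolding D_def by blast
    with that show False ..
  qed
  have "D t"
  proof (rule ccontr)
    assume nD: "\<not> D t"
    \<comment> \<open>On \<open>D\<close> nothing is demanded, so that every history allows a set of
      \<open>U\<close>.\<close>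
    define \<phi>0 where "\<phi>0 s n \<longleftrightarrow> (\<not> D s \<longrightarrow> \<not> D (n # s) \<and> \<not> improves U Z (n # s) u)" for s n
    have st0: "eventually (\<phi>0 s) U" for s
      using not_D[of s] unfolding \<phi>0_def by (cases "D s") auto
    have "\<exists>\<phi>. strategy U \<phi> \<and> (\<not> positive U Z s (i # u) \<longrightarrow> \<not> (\<exists>(x, w)\<in>Z. hist x (length s) = s \<and>
        hist w (length (i # u)) = i # u \<and> obeys \<phi> (length s) x))" for s i
    proof (cases "positive U Z s (i # u)")
      case True
      then show ?thesis by (intro exI[of _ "\<lambda>_ _. True"]) (auto simp: strategy_def)
    next
      case False
      then show ?thesis unfolding positive_def by blast
    qed
    then obtain \<phi> where \<phi>: "\<And>s i. strategy U (\<phi> s i)"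
      "\<And>s i x w. \<lbrakk>\<not> positive U Z s (i # u); (x, w) \<in> Z; hist x (length s) = s;
        hist w (length (i # u)) = i # u\<rbrakk> \<Longrightarrow> \<not> obeys (\<phi> s i) (length s) x"
      by (metis (mono_tags, lifting) case_prodI)
    \<comment> \<open>For \<open>k \<le> length s\<close> the list \<open>drop k s\<close> runs
      through \<open>s\<close> and all earlier histories, so every refutation begun along the way
      stays in force. Both ranges are finite, hence the conjunction still holds on a set of
      \<open>U\<close>.\<close>
    define \<Phi> where "\<Phi> s n \<longleftrightarrow> \<phi>0 s n \<and> (\<forall>k\<in>{..length s}. \<forall>i\<in>{..length s}. \<phi> (drop k s) i s n)" for s n
    have "strategy U \<Phi>"
      using st0 \<phi>(1) unfolding strategy_def \<Phi>_def
      by (auto intro!: eventually_conj eventually_ball_finite)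
    then obtain x w where xw: "(x, w) \<in> Z" and hx: "hist x (length t) = t"
      and hw: "hist w (length u) = u" and ob: "obeys \<Phi> (length t) x"
      using pos unfolding positive_def by blast
    have nDk: "\<not> D (hist x k)" if "k \<ge> length t" for k
      using that
    proof (induction k rule: dec_induct)
      case base
      then show ?case using nD hx by simp
    next
      case (step k)
      then show ?case using ob by (auto simp: obeys_def \<Phi>_def \<phi>0_def)
    qed
    have nI: "\<not> improves U Z (hist x (Suc k)) u" if "k \<ge> length t" for k
      using nDk[OF that] ob that by (auto simp: obeys_def \<Phi>_def \<phi>0_def)
    define i where "i = w (length u)"
    \<comment> \<open>From this stage on \<open>i\<close> is at most the length of the history, so
      \<open>\<Phi>\<close> imposes \<open>\<phi> (hist x k) i\<close>. The successor matters:
      improvements are excluded only at proper extensions of \<open>t\<close>.\<close>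
    define k where "k = Suc (max (length t) i)"
    have "\<not> positive U Z (hist x k) (i # u)"
      using nI[of "max (length t) i"] unfolding k_def improves_def by auto
    then have "\<not> obeys (\<phi> (hist x k) i) k x"
      using \<phi>(2)[of "hist x k" i x w] xw hw by (auto simp: i_def)
    moreover have "\<phi> (hist x k) i (hist x n) (x n)" if "n \<ge> k" for n
    proof -
      have "\<Phi> (hist x n) (x n)" using ob that by (auto simp: obeys_def k_def)
      moreover have "drop (n - k) (hist x n) = hist x k" using that by (rule drop_hist)
      moreover have "i \<le> n" "n - k \<le> n" using that by (auto simp: k_def)
      ultimately show ?thesis unfolding \<Phi>_def by (metis atMost_iff length_hist)
    qed
    ultimately show False unfolding obeys_def by blast
  qed
  then show ?thesis unfolding D_def .
qed

text \<open>The prescriptions of the previous lemma are followed one after another: as soon as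
  \<open>u\<close> can be improved it receives a new entry, and play switches to the prescription
  for the new position. Along an obedient \<open>x\<close> the lists \<open>u\<close> grow without
  bound and build \<open>W x\<close>. Only approximations in \<open>Z\<close> result, which suffices
  for closed conditions on \<open>w\<close>.\<close>

lemma positive_imp_continuous_witness:
  assumes ultra: "\<And>P. eventually P U \<or> eventually (\<lambda>n. \<not> P n) U"
    and pos: "positive U Z [] []"
  obtains \<phi> W where "strategy U \<phi>"
    "\<And>x n. obeys \<phi> 0 x \<Longrightarrow> \<exists>(x', w')\<in>Z. hist x' n = hist x n \<and> hist w' n = hist (W x) n"
    "\<And>x j. obeys \<phi> 0 x \<Longrightarrow> \<exists>k. \<forall>y. hist y k = hist x k \<longrightarrow> W y j = W x j"
proof -
  have "\<forall>t u. \<exists>\<psi>. positive U Z t u \<longrightarrow> strategy U \<psi> \<and> (\<forall>x. hist x (length t) = t \<longrightarrow>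
    obeys \<psi> (length t) x \<longrightarrow> (\<exists>k>length t. improves U Z (hist x k) u))"
    by (intro allI) (metis positive_imp_strategy_improves[OF ultra])
  then obtain \<psi> where \<psi>: "\<forall>t u. positive U Z t u \<longrightarrow> strategy U (\<psi> t u) \<and>
    (\<forall>x. hist x (length t) = t \<longrightarrow> obeys (\<psi> t u) (length t) x \<longrightarrow>
      (\<exists>k>length t. improves U Z (hist x k) u))"
    unfolding choice_iff by blast
  \<comment> \<open>\<open>st t\<close> is the last history at which \<open>u\<close> was extended, with the value of \<open>u\<close>.\<close>
  define st where "st = rec_list ([], []) (\<lambda>n r s. if improves U Z (n # r) (snd s)
    then (n # r, (SOME i. positive U Z (n # r) (i # snd s)) # snd s) else s)"
  have st_Nil: "st [] = ([], [])"
    and st_Cons: "st (n # r) = (if improves U Z (n # r) (snd (st r))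
      then (n # r, (SOME i. positive U Z (n # r) (i # snd (st r))) # snd (st r)) else st r)" for n r
    by (simp_all add: st_def)
  have pos_st: "positive U Z (fst (st t)) (snd (st t))" for t
  proof (induction t)
    case Nil
    then show ?case using pos by (simp add: st_Nil)
  next
    case (Cons n r)
    then show ?case by (auto simp: st_Cons improves_def intro: someI)
  qed
  define \<phi> where "\<phi> t = \<psi> (fst (st t)) (snd (st t)) t" for t
  \<comment> \<open>Entry \<open>j\<close> is read off at the first stage where \<open>u\<close> is
    long enough; \<open>rev\<close> is needed because \<open>u\<close> has its latest entry first.
    Later stages give the same value (\<open>W_nth\<close>), which yields continuity.\<close>
  define W where
    "W x j = rev (snd (st (hist x (LEAST k. j < length (snd (st (hist x k))))))) ! j" for x j
  have strat: "strategy U \<phi>"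
    using \<psi> pos_st by (auto simp: strategy_def \<phi>_def)
  \<comment> \<open>The last clause holds because extensions of \<open>u\<close> happen at strictly
    increasing stages. At the end it lets one stage control initial segments of both
    \<open>x\<close> and \<open>W x\<close>.\<close>
  have inv: "hist x (length (fst (st (hist x k)))) = fst (st (hist x k)) \<and>
     length (fst (st (hist x k))) \<le> k \<and>
     (\<forall>j. length (fst (st (hist x k))) \<le> j \<and> j \<le> k \<longrightarrow> st (hist x j) = st (hist x k)) \<and>
     length (snd (st (hist x k))) \<le> length (fst (st (hist x k)))" for x k
  proof (induction k)
    case 0
    then show ?case by (simp add: st_Nil)
  next
    case (Suc k)
    show ?case
    proof (cases "improves U Z (hist x (Suc k)) (snd (st (hist x k)))")
      case True
      then have "fst (st (hist x (Suc k))) = hist x (Suc k)"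
        "length (snd (st (hist x (Suc k)))) = Suc (length (snd (st (hist x k))))"
        by (simp_all add: st_Cons)
      moreover have "length (snd (st (hist x k))) \<le> k" using Suc by linarith
      ultimately show ?thesis by (simp del: hist.simps) (metis le_antisym)
    next
      case False
      then have eq: "st (hist x (Suc k)) = st (hist x k)" by (simp add: st_Cons)
      show ?thesis unfolding eq using Suc eq by (metis le_SucI le_Suc_eq)
    qed
  qed
  have mono_Suc: "\<exists>v. snd (st (hist x (Suc k))) = v @ snd (st (hist x k))" for x k
    by (auto simp: st_Cons)
  have mono: "\<exists>v. snd (st (hist x k)) = v @ snd (st (hist x j))" if "j \<le> k" for x j k
    using that
  proof (induction k rule: dec_induct)
    case base
    then show ?case by simp
  next
    case (step k)
    then show ?case using mono_Suc[of x k] by (metis append.assoc)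
  qed
  \<comment> \<open>Otherwise the state is frozen at some \<open>(t, u)\<close> from stage
    \<open>length t\<close> on. Then \<open>x\<close> obeys \<open>\<psi> t u\<close> from there,
    and the improvement this forces would extend \<open>u\<close>.\<close>
  have grow: "\<exists>k'. length (snd (st (hist x k))) < length (snd (st (hist x k')))"
    if ob: "obeys \<phi> 0 x" for x k
  proof (rule ccontr)
    assume no: "\<nexists>k'. length (snd (st (hist x k))) < length (snd (st (hist x k')))"
    obtain t u where tu: "st (hist x k) = (t, u)" by fastforce
    have const: "st (hist x j) = (t, u)" if "length t \<le> j" for j
    proof (cases "j \<le> k")
      case True
      then show ?thesis using inv[of x k] tu that by auto
    next
      case False
      then have "k \<le> j" by simp
      then show ?thesis
      proof (induction j rule: dec_induct)
        case base
        then show ?case using tu by simp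
      next
        case (step j)
        have "\<not> improves U Z (hist x (Suc j)) u"
        proof
          assume "improves U Z (hist x (Suc j)) u"
          then have "length (snd (st (hist x (Suc j)))) = Suc (length u)"
            using step.IH by (simp add: st_Cons)
          then show False using no tu by (metis lessI snd_conv)
        qed
        then show ?case using step.IH by (simp add: st_Cons)
      qed
    qed
    have "obeys (\<psi> t u) (length t) x"
      unfolding obeys_def
    proof (intro allI impI)
      fix n assume "length t \<le> n"
      then show "\<psi> t u (hist x n) (x n)"
        using ob[unfolded obeys_def \<phi>_def, rule_format, of n] const[of n] by simp
    qed
    moreover have "positive U Z t u" "hist x (length t) = t"
      using pos_st[of "hist x k"] inv[of x k] tu by auto
    ultimately obtain k' where k': "k' > length t" "improves U Z (hist x k') u"
      using \<psi> by blast
    then obtain j where j: "k' = Suc j" "length t \<le> j" by (cases k') auto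
    then have "length (snd (st (hist x k'))) = Suc (length u)"
      using const[of j] k'(2) by (simp add: st_Cons)
    then show False using no tu by (metis lessI snd_conv)
  qed
  have unbounded: "\<exists>k. n < length (snd (st (hist x k)))" if ob: "obeys \<phi> 0 x" for x n
  proof (induction n)
    case 0
    then show ?case using grow[OF ob, of 0] by (metis gr_zeroI less_zeroE)
  next
    case (Suc n)
    then show ?case using grow[OF ob] by (meson Suc_lessI less_trans_Suc)
  qed
  have W_nth: "W x j = rev (snd (st (hist x k))) ! j" if j: "j < length (snd (st (hist x k)))" for x j k
  proof -
    define l where "l = (LEAST k. j < length (snd (st (hist x k))))"
    have l: "j < length (snd (st (hist x l)))" "l \<le> k"
      unfolding l_def using j by (auto intro: LeastI Least_le)
    obtain v where "snd (st (hist x k)) = v @ snd (st (hist x l))" using mono[OF l(2)] by blast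
    then show ?thesis using l(1) by (simp add: W_def nth_append flip: l_def)
  qed
  have W_hist: "hist (W x) (length (snd (st (hist x k)))) = snd (st (hist x k))" for x k
    by (rule rev_is_rev_conv[THEN iffD1], rule nth_equalityI) (auto simp: rev_hist W_nth)
  show thesis
  proof (rule that[OF strat, of W])
    fix x n assume ob: "obeys \<phi> 0 x"
    obtain k where k: "n < length (snd (st (hist x k)))" using unbounded[OF ob] by blast
    define t u where "t = fst (st (hist x k))" and "u = snd (st (hist x k))"
    \<comment> \<open>Positivity tested against the prescription without demands gives a member of
      \<open>Z\<close> through the position.\<close>
    have "strategy U (\<lambda>_ _. True)" by (simp add: strategy_def)
    then obtain x' w' where Z: "(x', w') \<in> Z" "hist x' (length t) = t" "hist w' (length u) = u"
      using pos_st[of "hist x k"] unfolding positive_def t_def u_def by blast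
    have tu: "hist x (length t) = t" "length u \<le> length t"
      using inv[of x k] unfolding t_def u_def by blast+
    have "hist x' (length t) = hist x (length t)" "hist w' (length u) = hist (W x) (length u)"
      using Z tu(1) W_hist[of x k] unfolding u_def by simp_all
    moreover have "n \<le> length t" "n \<le> length u"
      using k tu(2) unfolding u_def by linarith+
    ultimately have "hist x' n = hist x n" "hist w' n = hist (W x) n"
      by (auto simp: hist_eq_iff)
    then show "\<exists>(x', w')\<in>Z. hist x' n = hist x n \<and> hist w' n = hist (W x) n"
      using Z(1) by blast
  next
    fix x j assume ob: "obeys \<phi> 0 x"
    obtain k where "j < length (snd (st (hist x k)))" using unbounded[OF ob] by blast
    then show "\<exists>k. \<forall>y. hist y k = hist x k \<longrightarrow> W y j = W x j"
      using W_nth by metis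
  qed
qed

text \<open>\<open>h k\<close> is taken from a finite intersection of sets of \<open>U\<close>, one
  for each short list of earlier values and one keeping \<open>h\<close> increasing. Hence every
  subsequence of \<open>h\<close> obeys \<open>\<phi>\<close>: its entry number \<open>n\<close> has
  index at least \<open>n\<close> in \<open>h\<close>.\<close>

lemma strategy_imp_sparse_sequence:
  assumes U: "U \<noteq> bot" "U \<le> cofinite" and strat: "strategy U \<phi>"
  obtains h where "strict_mono h"
    "\<And>k t. set t \<subseteq> h ` {..<k} \<Longrightarrow> length t \<le> k \<Longrightarrow> \<phi> t (h k)"
proof -
  define P where "P h k r \<longleftrightarrow> (\<forall>i\<in>{..<k}. h i < r) \<and>
    (\<forall>t\<in>{t. set t \<subseteq> h ` {..<k} \<and> length t \<le> k}. \<phi> t r)" for h k and r :: nat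
  have "\<exists>h. \<forall>k. P h k (h k)"
  proof (rule dependent_wellorder_choice)
    fix r f g and k :: nat
    assume "\<And>y. y < k \<Longrightarrow> f y = (g y :: nat)"
    then have "f ` {..<k} = g ` {..<k}" "(\<forall>i\<in>{..<k}. f i < r) \<longleftrightarrow> (\<forall>i\<in>{..<k}. g i < r)"
      by (auto simp: image_iff)
    then show "P f k r = P g k r" by (simp only: P_def)
  next
    fix k f
    have "eventually (\<lambda>n. m < n) U" for m
      using eventually_gt_at_top[of m] U(2) unfolding cofinite_eq_sequentially le_filter_def by blast
    moreover have "eventually (\<phi> t) U" for t
      using strat by (simp add: strategy_def)
    ultimately have "eventually (P f k) U"
      unfolding P_def by (intro eventually_conj eventually_ball_finite) (auto intro: finite_lists_length_le)
    then show "\<exists>r. P f k r" using U(1) by (metis eventually_happens)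
  qed
  then obtain h where h: "\<And>k. P h k (h k)" by blast
  have "strict_mono h"
    by (rule strict_monoI) (use h in \<open>auto simp: P_def\<close>)
  then show thesis using that h by (auto simp: P_def)
qed

section \<open>Borel sets as projections of closed sets\<close>

text \<open>Makes the Borel sets of a countable power of \<open>bool\<close> the product
  sigma-algebra (\<open>sets_PiM_equal_borel\<close>).\<close>

instance bool :: second_countable_topology
proof
  have "open = generate_topology (UNIV :: bool set set)"
    by (auto simp: fun_eq_iff open_discrete intro: generate_topology.Basis)
  then show "\<exists>B :: bool set set. countable B \<and> open = generate_topology B"
    by (intro exI[of _ UNIV]) (simp add: countable_finite)
qed

lemma tendsto_fun_iff:
  fixes f :: "'c \<Rightarrow> 'a \<Rightarrow> 'b::topological_space"
  shows "(f \<longlongrightarrow> l) F \<longleftrightarrow> (\<forall>i. ((\<lambda>c. f c i) \<longlongrightarrow> l i) F)"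
  using limitin_componentwise[of "\<lambda>_. euclidean" UNIV f l F]
  by (simp add: euclidean_product_topology)

text \<open>Members of \<open>D\<close> agreeing with \<open>w\<close> on longer and longer initial
  segments converge to \<open>w\<close>, each coordinate being eventually constant.\<close>

lemma closed_hist_closure:
  fixes D :: "(nat \<Rightarrow> 'a::topological_space) set"
  assumes "closed D" and "\<And>n. \<exists>w'\<in>D. hist w' n = hist w n"
  shows "w \<in> D"
proof -
  obtain f where f: "\<And>n. f n \<in> D" "\<And>n. hist (f n) n = hist w n"
    using assms(2) by metis
  have "f \<longlonglongrightarrow> w"
    unfolding tendsto_fun_iff
  proof
    fix i
    have "eventually (\<lambda>n. f n i = w i) sequentially"
      using eventually_gt_at_top[of i] by eventually_elim (use f(2) in \<open>auto simp: hist_eq_iff\<close>)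
    then show "(\<lambda>n. f n i) \<longlonglongrightarrow> w i" by (rule tendsto_eventually)
  qed
  then show ?thesis
    using assms(1) f(1) by (intro Lim_in_closed_set[of D f sequentially]) auto
qed

text \<open>Such an \<open>f\<close> is locally constant, because fixing finitely many discrete
  coordinates is an open condition.\<close>

lemma continuous_on_finitely_determined:
  fixes f :: "('a \<Rightarrow> 'b::discrete_topology) \<Rightarrow> 'c::topological_space"
  assumes "\<And>z. \<exists>J. finite J \<and> (\<forall>z'. (\<forall>j\<in>J. z' j = z j) \<longrightarrow> f z' = f z)"
  shows "continuous_on UNIV f"
proof -
  have "open (f -` B)" for B
  proof (subst open_subopen, intro ballI)
    fix z assume z: "z \<in> f -` B"
    obtain J where J: "finite J" "\<And>z'. (\<forall>j\<in>J. z' j = z j) \<Longrightarrow> f z' = f z"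
      using assms by blast
    have "open {z'. \<forall>j\<in>J. z' (id j) \<in> {z j}}"
      by (rule product_topology_basis') (auto simp: J open_discrete)
    moreover have "{z'. \<forall>j\<in>J. z' (id j) \<in> {z j}} \<subseteq> f -` B"
    proof
      fix z' assume "z' \<in> {z'. \<forall>j\<in>J. z' (id j) \<in> {z j}}"
      then have "f z' = f z" by (intro J(2)) simp
      then show "z' \<in> f -` B" using z by simp
    qed
    ultimately show "\<exists>T. open T \<and> z \<in> T \<and> T \<subseteq> f -` B" using z by (intro exI[of _ "{z'. \<forall>j\<in>J. z' (id j) \<in> {z j}}"] conjI) simp_all
  qed
  then show ?thesis by (simp add: continuous_on_open_vimage)
qed

text \<open>A witness for the union carries the index \<open>n\<close> in entry 0 and a witness for
  \<open>C n\<close> in its tail. Writing this as an intersection over \<open>n\<close> keeps it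
  closed, since fixing a discrete entry is a clopen condition.\<close>

lemma UN_projections_closed:
  fixes C :: "nat \<Rightarrow> ('a::topological_space \<times> (nat \<Rightarrow> nat)) set"
  assumes "\<And>n. closed (C n)"
  shows "\<exists>C'. closed C' \<and> (\<Union>n. fst ` C n) = fst ` (C' :: ('a \<times> (nat \<Rightarrow> nat)) set)"
proof (intro exI conjI)
  let ?g = "\<lambda>p :: 'a \<times> (nat \<Rightarrow> nat). (fst p, \<lambda>i. snd p (Suc i))"
  let ?C = "\<Inter>n. {p. snd p 0 \<noteq> n} \<union> ?g -` C n"
  have cont: "continuous_on UNIV (\<lambda>p :: 'a \<times> (nat \<Rightarrow> nat). snd p i)" for i
    by (rule continuous_on_product_then_coordinatewise[OF continuous_on_snd[OF continuous_on_id]])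
  have "continuous_on UNIV ?g"
    proof (rule continuous_on_Pair[OF continuous_on_fst[OF continuous_on_id]])
    show "continuous_on UNIV (\<lambda>(p :: 'a \<times> (nat \<Rightarrow> nat)) i. snd p (Suc i))"
      by (rule continuous_on_coordinatewise_then_product) (rule cont)
  qed
  moreover have "closed {p :: 'a \<times> (nat \<Rightarrow> nat). snd p 0 \<noteq> n}" for n
  proof -
    have "closed ((\<lambda>p :: 'a \<times> (nat \<Rightarrow> nat). snd p 0) -` (- {n}))"
      by (intro closed_vimage cont) (auto simp: closed_def open_discrete)
    then show ?thesis by (simp add: vimage_def)
  qed
  ultimately show "closed ?C"
    using assms by (intro closed_INT ballI closed_Un closed_vimage) auto
  show "(\<Union>n. fst ` C n) = fst ` ?C"
  proof (intro equalityI subsetI)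
    fix a assume "a \<in> (\<Union>n. fst ` C n)"
    then obtain n y where "(a, y) \<in> C n" by auto
    then have "(a, case_nat n y) \<in> ?C" by auto
    then show "a \<in> fst ` ?C" by (rule image_eqI[rotated]) simp
  next
    fix a assume "a \<in> fst ` ?C"
    then obtain y where "(a, y) \<in> ?C" by auto
    then have "(a, \<lambda>i. y (Suc i)) \<in> C (y 0)" by auto
    then show "a \<in> (\<Union>n. fst ` C n)" by force
  qed
qed

text \<open>One sequence holds witnesses for all \<open>n\<close> at once, the one for
  \<open>C n\<close> at the positions \<open>prod_encode (n, i)\<close>.\<close>

lemma INT_projections_closed:
  fixes C :: "nat \<Rightarrow> ('a::topological_space \<times> (nat \<Rightarrow> nat)) set"
  assumes "\<And>n. closed (C n)"
  shows "\<exists>C'. closed C' \<and> (\<Inter>n. fst ` C n) = fst ` (C' :: ('a \<times> (nat \<Rightarrow> nat)) set)"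
proof (intro exI conjI)
  let ?g = "\<lambda>n (p :: 'a \<times> (nat \<Rightarrow> nat)). (fst p, \<lambda>i. snd p (prod_encode (n, i)))"
  let ?C = "\<Inter>n. ?g n -` C n"
  have cont: "continuous_on UNIV (\<lambda>p :: 'a \<times> (nat \<Rightarrow> nat). snd p i)" for i
    by (rule continuous_on_product_then_coordinatewise[OF continuous_on_snd[OF continuous_on_id]])
  have "continuous_on UNIV (?g n)" for n
    proof (rule continuous_on_Pair[OF continuous_on_fst[OF continuous_on_id]])
    show "continuous_on UNIV (\<lambda>(p :: 'a \<times> (nat \<Rightarrow> nat)) i. snd p (prod_encode (n, i)))"
      by (rule continuous_on_coordinatewise_then_product) (rule cont)
  qed
  then show "closed ?C"
    using assms by (intro closed_INT ballI closed_vimage) auto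
  show "(\<Inter>n. fst ` C n) = fst ` ?C"
  proof (intro equalityI subsetI)
    fix a assume "a \<in> (\<Inter>n. fst ` C n)"
    then have "\<forall>n. \<exists>y. (a, y) \<in> C n" by force
    then obtain y where "\<And>n. (a, y n) \<in> C n" by metis
    then have "(a, \<lambda>k. case prod_decode k of (n, i) \<Rightarrow> y n i) \<in> ?C" by auto
    then show "a \<in> fst ` ?C" by (rule image_eqI[rotated]) simp
  next
    fix a assume "a \<in> fst ` ?C"
    then show "a \<in> (\<Inter>n. fst ` C n)" by force
  qed
qed

text \<open>Induction on the generation of the sigma-algebra, for \<open>X\<close> and its
  complement together: the complement step is then a swap, and a union requires a union on one side
  and an intersection on the other. The generators are clopen.\<close>

lemma borel_imp_projection_closed:
  fixes X :: "('a::countable \<Rightarrow> bool) set"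
  assumes "X \<in> sets borel"
  obtains C :: "(('a \<Rightarrow> bool) \<times> (nat \<Rightarrow> nat)) set" where "closed C" "X = fst ` C"
proof -
  define P where "P X \<longleftrightarrow> (\<exists>C :: (('a \<Rightarrow> bool) \<times> (nat \<Rightarrow> nat)) set. closed C \<and> X = fst ` C)"
    for X :: "('a \<Rightarrow> bool) set"
  have closed_P: "P C" if "closed C" for C
    unfolding P_def using that
    by (intro exI[of _ "C \<times> UNIV"]) (auto intro: closed_Times)
  have P_UN: "P (\<Union>n. A n)" if "\<And>n. P (A n)" for A :: "nat \<Rightarrow> _"
  proof -
    have "\<forall>n. \<exists>C :: (('a \<Rightarrow> bool) \<times> (nat \<Rightarrow> nat)) set. closed C \<and> A n = fst ` C"
      using that by (simp add: P_def)
    then obtain C :: "nat \<Rightarrow> (('a \<Rightarrow> bool) \<times> (nat \<Rightarrow> nat)) set"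
      where "\<And>n. closed (C n) \<and> A n = fst ` C n"
      by (metis (no_types))
    then show ?thesis using UN_projections_closed[of C] by (simp add: P_def)
  qed
  have P_INT: "P (\<Inter>n. A n)" if "\<And>n. P (A n)" for A :: "nat \<Rightarrow> _"
  proof -
    have "\<forall>n. \<exists>C :: (('a \<Rightarrow> bool) \<times> (nat \<Rightarrow> nat)) set. closed C \<and> A n = fst ` C"
      using that by (simp add: P_def)
    then obtain C :: "nat \<Rightarrow> (('a \<Rightarrow> bool) \<times> (nat \<Rightarrow> nat)) set"
      where "\<And>n. closed (C n) \<and> A n = fst ` C n"
      by (metis (no_types))
    then show ?thesis using INT_projections_closed[of C] by (simp add: P_def)
  qed
  have "X \<in> sets (PiM UNIV (\<lambda>_::'a. borel :: bool measure))"
    using assms by (simp add: sets_PiM_equal_borel)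
  then have "X \<in> sigma_sets UNIV {{f. f i \<in> A} | i A. A \<in> sets (borel :: bool measure)}"
    unfolding sets_PiM_single by simp
  then have "P X \<and> P (- X)"
  proof (induction rule: sigma_sets.induct)
    case (Basic X)
    then obtain i A where X: "X = (\<lambda>f. f i) -` A" by (auto simp: vimage_def)
    have "closed ((\<lambda>f :: 'a \<Rightarrow> bool. f i) -` A)" for A
      by (intro closed_vimage) (auto simp: closed_def open_discrete)
    then show ?case unfolding X by (auto intro: closed_P simp flip: vimage_Compl)
  next
    case Empty
    then show ?case by (auto intro: closed_P)
  next
    case (Compl X)
    then show ?case by (simp add: Compl_eq_Diff_UNIV[symmetric])
  next
    case (Union A)
    then show ?case using P_UN[of A] P_INT[of "\<lambda>n. - A n"] by (simp add: Compl_UN)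
  qed
  then show thesis using that by (auto simp: P_def)
qed

section \<open>Coarsenings and minima of classes\<close>

text \<open>The right-hand side depends only on the part of \<open>S\<close> up to \<open>v\<close>,
  so values of \<open>enumerate\<close> carry over between sets that agree that far.\<close>

lemma enumerate_eq_iff:
  fixes S :: "nat set"
  assumes S: "infinite S"
  shows "enumerate S i = v \<longleftrightarrow> v \<in> S \<and> card (S \<inter> {..<v}) = i"
proof -
  have card: "card (S \<inter> {..<enumerate S i}) = i" for i
  proof -
    have "S \<inter> {..<enumerate S i} = enumerate S ` {..<i}"
    proof (intro equalityI subsetI)
      fix s assume "s \<in> S \<inter> {..<enumerate S i}"
      then obtain j where "enumerate S j = s" "s < enumerate S i"
        using enumerate_Ex[OF S] by blast
      then show "s \<in> enumerate S ` {..<i}" using S by auto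
    qed (use S in \<open>auto simp: enumerate_in_set\<close>)
    then show ?thesis
      using inj_enumerate[OF S] by (simp add: card_image inj_on_subset)
  qed
  show ?thesis
  proof
    assume "enumerate S i = v"
    then show "v \<in> S \<and> card (S \<inter> {..<v}) = i"
      using card[of i] enumerate_in_set[OF S, of i] by simp
  next
    assume v: "v \<in> S \<and> card (S \<inter> {..<v}) = i"
    then obtain j where "enumerate S j = v" using enumerate_Ex[OF S] by blast
    then show "enumerate S i = v" using card[of j] v by simp
  qed
qed

definition mins :: "(nat \<times> nat \<Rightarrow> bool) \<Rightarrow> nat set" where
  "mins A = {k. \<forall>j<k. \<not> A (j, k)}"

lemma equiv_Collect_iff:
  "equiv UNIV (Collect A) \<longleftrightarrow> (\<forall>i. A (i, i)) \<and> (\<forall>i j. A (i, j) \<longrightarrow> A (j, i)) \<and>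
    (\<forall>i j k. A (i, j) \<longrightarrow> A (j, k) \<longrightarrow> A (i, k))"
proof
  assume "equiv UNIV (Collect A)"
  then have "refl (Collect A)" "sym (Collect A)" "trans (Collect A)"
    by (auto elim: equivE)
  then show "(\<forall>i. A (i, i)) \<and> (\<forall>i j. A (i, j) \<longrightarrow> A (j, i)) \<and>
      (\<forall>i j k. A (i, j) \<longrightarrow> A (j, k) \<longrightarrow> A (i, k))"
    by (meson CollectD CollectI UNIV_I refl_onD symD transD)
next
  assume A: "(\<forall>i. A (i, i)) \<and> (\<forall>i j. A (i, j) \<longrightarrow> A (j, i)) \<and>
      (\<forall>i j k. A (i, j) \<longrightarrow> A (j, k) \<longrightarrow> A (i, k))"
  show "equiv UNIV (Collect A)"
  proof (rule equivI)
    show "refl (Collect A)" using A by (intro refl_onI) auto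
    show "sym (Collect A)" using A by (intro symI) blast
    show "trans (Collect A)" using A by (intro transI) blast
  qed simp
qed

lemma ex_mins:
  assumes "equiv UNIV (Collect A)"
  obtains r where "r \<in> mins A" "A (r, i)" "r \<le> i"
proof
  let ?r = "LEAST j. A (j, i)"
  have i: "A (i, i)" and trans: "\<And>j k. A (j, k) \<Longrightarrow> A (k, i) \<Longrightarrow> A (j, i)"
    using assms unfolding equiv_Collect_iff by blast+
  show r: "A (?r, i)" using i by (rule LeastI)
  show "?r \<le> i" using i by (rule Least_le)
  have "\<not> A (j, ?r)" if "j < ?r" for j
    using trans[OF _ r] not_less_Least[OF that] by blast
  then show "?r \<in> mins A" by (simp add: mins_def)
qed

lemma mins_inj:
  assumes A: "equiv UNIV (Collect A)" and ij: "i \<in> mins A" "j \<in> mins A" "A (i, j)"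
  shows "i = j"
proof (rule linorder_cases)
  assume "i < j"
  then show ?thesis using ij by (simp add: mins_def)
next
  have "A (j, i)" using A ij(3) unfolding equiv_Collect_iff by blast
  moreover assume "j < i"
  ultimately show ?thesis using ij by (simp add: mins_def)
qed

text \<open>Sending a minimum to its class is a bijection from minima to classes.\<close>

lemma E_infty_iff: "A \<in> E_infty \<longleftrightarrow> equiv UNIV (Collect A) \<and> infinite (mins A)"
proof -
  have "bij_betw (\<lambda>k. Collect A `` {k}) (mins A) (classes A)" if A: "equiv UNIV (Collect A)"
    unfolding bij_betw_def
  proof (intro conjI equalityI subsetI)
    show "inj_on (\<lambda>k. Collect A `` {k}) (mins A)"
    proof (rule inj_onI)
      fix i j assume ij: "i \<in> mins A" "j \<in> mins A" "Collect A `` {i} = Collect A `` {j}"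
      then have "A (i, j)"
        using eq_equiv_class[OF ij(3) A] by simp
        with ij A show "i = j" by (blast intro: mins_inj)
    qed
  next
    fix C assume "C \<in> classes A"
    then obtain i where C: "C = Collect A `` {i}" by (auto elim: quotientE)
    obtain r where r: "r \<in> mins A" "A (r, i)" using ex_mins[OF A] by blast
    then have "C = Collect A `` {r}"
      unfolding C using equiv_class_eq[OF A, of r i] by simp
    then show "C \<in> (\<lambda>k. Collect A `` {k}) ` mins A" using r(1) by blast
  next
    fix C assume "C \<in> (\<lambda>k. Collect A `` {k}) ` mins A"
    then show "C \<in> classes A" by (auto intro: quotientI)
  qed
  then show ?thesis unfolding E_infty_def using bij_betw_finite by blast
qed

lemma coarser_iff:
  assumes A: "equiv UNIV (Collect A)" and B: "equiv UNIV (Collect B)"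
  shows "coarser A B \<longleftrightarrow> (\<forall>i j. B (i, j) \<longrightarrow> A (i, j))"
proof
  assume co: "coarser A B"
  show "\<forall>i j. B (i, j) \<longrightarrow> A (i, j)"
  proof (intro allI impI)
    fix i j assume ij: "B (i, j)"
    have "Collect A `` {i} \<in> classes A" by (simp add: quotientI)
    then obtain S where S: "S \<subseteq> classes B" "Collect A `` {i} = \<Union>S"
      using co unfolding coarser_def by blast
    have "i \<in> Collect A `` {i}" using A by (simp add: equiv_Collect_iff)
    then obtain D where D: "D \<in> S" "i \<in> D" using S by auto
    then obtain k where k: "D = Collect B `` {k}" using S(1) by (auto elim: quotientE)
    then have "j \<in> D"
      using D(2) ij B unfolding equiv_Collect_iff by blast
    then show "A (i, j)" using S(2) D(1) by auto
  qed
next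
  assume sub: "\<forall>i j. B (i, j) \<longrightarrow> A (i, j)"
  show "coarser A B"
    unfolding coarser_def
  proof
    fix C assume "C \<in> classes A"
    then obtain i where C: "C = Collect A `` {i}" by (auto elim: quotientE)
    have "C = \<Union> ((\<lambda>x. Collect B `` {x}) ` C)"
    proof (intro equalityI subsetI)
      fix x assume "x \<in> C"
      then show "x \<in> \<Union> ((\<lambda>x. Collect B `` {x}) ` C)" using B unfolding equiv_Collect_iff by blast
    next
      fix x assume "x \<in> \<Union> ((\<lambda>x. Collect B `` {x}) ` C)"
      then obtain z where "A (i, z)" "B (z, x)" unfolding C by auto
      then show "x \<in> C" using A sub unfolding C equiv_Collect_iff by blast
    qed
    moreover have "(\<lambda>x. Collect B `` {x}) ` C \<subseteq> classes B" by (auto intro: quotientI)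
    ultimately show "\<exists>S\<subseteq>classes B. C = \<Union>S" by blast
  qed
qed

lemma cube_iff:
  assumes "B \<in> E_infty"
  shows "A \<in> cube m B \<longleftrightarrow> A \<in> E_infty \<and> (\<forall>i j. B (i, j) \<longrightarrow> A (i, j)) \<and>
    (\<forall>i<m. \<forall>j<m. A (i, j) \<longleftrightarrow> B (i, j))"
proof -
  have "Restr (Collect A) {..<m} = Restr (Collect B) {..<m} \<longleftrightarrow>
      (\<forall>i<m. \<forall>j<m. A (i, j) \<longleftrightarrow> B (i, j))"
    by (auto simp: set_eq_iff)
  then show ?thesis
    using assms coarser_iff[of A B] by (auto simp: cube_def E_infty_iff)
qed

text \<open>Restricting to the single point 0 carries no information. This allows \<open>m\<close>
  to be taken positive, so that the class of 0 is available for merging.\<close>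

lemma cube_0:
  assumes "B \<in> E_infty"
  shows "cube 0 B = cube 1 B"
proof -
  have "A (0, 0)" if "A \<in> E_infty" for A
    using that unfolding E_infty_iff equiv_Collect_iff by blast
  then show ?thesis
    unfolding set_eq_iff cube_iff[OF assms] using assms by (simp add: less_Suc_eq) blast
qed

lemma cube_refl: "B \<in> E_infty \<Longrightarrow> B \<in> cube m B"
  by (simp add: cube_iff)

lemma mins_cube:
  assumes "B \<in> E_infty" "A \<in> cube m B"
  shows "mins A \<subseteq> mins B" "mins A \<inter> {..<m} = mins B \<inter> {..<m}"
  using assms by (auto simp: cube_iff mins_def)

text \<open>All classes of \<open>B\<close> with minimum outside \<open>K\<close> are merged into
  the class of 0. Nothing changes below \<open>m\<close>, because the minima there all belong to
  \<open>K\<close>.\<close>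

lemma ex_cube_mins_subset:
  assumes B: "B \<in> E_infty" and m: "0 < m"
    and K: "K \<subseteq> mins B" "infinite K" "mins B \<inter> {..<m} \<subseteq> K"
  shows "\<exists>B'\<in>cube m B. mins B' \<subseteq> K"
proof -
  have eqB: "equiv UNIV (Collect B)" using B by (simp add: E_infty_iff)
  obtain r where r: "\<And>i. r i \<in> mins B" "\<And>i. B (r i, i)" "\<And>i. r i \<le> i"
  proof -
    have "\<forall>i. \<exists>r. r \<in> mins B \<and> B (r, i) \<and> r \<le> i" using ex_mins[OF eqB] by blast
    then show thesis using that unfolding choice_iff by blast
  qed
  have r_eq: "r i = r j \<longleftrightarrow> B (i, j)" for i j
  proof
    assume "r i = r j"
    then show "B (i, j)" using r(2)[of i] r(2)[of j] eqB unfolding equiv_Collect_iff by metis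
  next
    assume "B (i, j)"
    then have "B (r i, r j)" using r(2)[of i] r(2)[of j] eqB unfolding equiv_Collect_iff by metis
    then show "r i = r j" using mins_inj[OF eqB] r(1) by blast
  qed
  have "0 \<in> K" using m K(3) by (auto simp: mins_def)
  \<comment> \<open>\<open>r i\<close> is the minimum of the old class of \<open>i\<close>, and
    \<open>\<rho> i\<close> that of the new one; \<open>B'\<close> is the kernel of
    \<open>\<rho>\<close>.\<close>
  define \<rho> where "\<rho> i = (if r i \<in> K then r i else 0)" for i
  define B' where "B' = (\<lambda>(i, j). \<rho> i = \<rho> j)"
  have r_id: "r k = k" if "k \<in> mins B" for k
    using mins_inj[OF eqB r(1)] r(2) that by blast
  have \<rho>_le: "\<rho> i \<le> i" and \<rho>_K: "\<rho> i \<in> K" for i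
    using r(3) \<open>0 \<in> K\<close> by (auto simp: \<rho>_def)
  have \<rho>_id: "\<rho> k = k" if "k \<in> K" for k
    using r_id that K(1) by (auto simp: \<rho>_def)
  have "mins B' = K"
  proof (intro equalityI subsetI)
    fix k assume "k \<in> mins B'"
    then have "\<not> \<rho> k < k" using \<rho>_id[OF \<rho>_K[of k]] by (auto simp: mins_def B'_def)
    then show "k \<in> K" using \<rho>_le[of k] \<rho>_K[of k] by (metis le_neq_implies_less)
  next
    fix k assume "k \<in> K"
    then show "k \<in> mins B'"
      using \<rho>_id[of k] \<rho>_le by (auto simp: mins_def B'_def) (metis leD)
  qed
  moreover have "equiv UNIV (Collect B')"
    unfolding equiv_Collect_iff B'_def by simp
  moreover have "B' (i, j)" if "B (i, j)" for i j
    using that r_eq[of i j] by (simp add: B'_def \<rho>_def)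
  moreover have "B' (i, j) \<longleftrightarrow> B (i, j)" if "i < m" "j < m" for i j
  proof -
    have "r l \<in> K" if "l < m" for l
      using K(3) r(1,3) that le_less_trans by blast
    then show ?thesis using that r_eq[of i j] by (simp add: B'_def \<rho>_def)
  qed
  ultimately have "B' \<in> cube m B"
    using B K(2) by (auto simp: cube_iff E_infty_iff)
  then show ?thesis using \<open>mins B' = K\<close> by blast
qed

section \<open>Coding of points and witnesses, and positivity of sets outside the ideal\<close>

text \<open>A single sequence encodes a relation, in the first components of its entries with 0 for
  true, and a point of the Baire space, in the second components. Each value of either depends on
  one entry of \<open>w\<close>, which gives continuity.\<close>

definition dec :: "(nat \<Rightarrow> nat) \<Rightarrow> (nat \<times> nat \<Rightarrow> bool) \<times> (nat \<Rightarrow> nat)" where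
  "dec w = (\<lambda>p. fst (prod_decode (w (prod_encode p))) = 0, \<lambda>k. snd (prod_decode (w k)))"

lemma surj_dec: "\<exists>w. dec w = (A, y)"
  by (rule exI[of _ "\<lambda>k. prod_encode (if A (prod_decode k) then 0 else 1, y k)"])
    (simp add: dec_def fun_eq_iff)

lemma continuous_on_dec: "continuous_on UNIV dec"
proof -
  have "continuous_on UNIV (\<lambda>(w :: nat \<Rightarrow> nat) p. fst (prod_decode (w (prod_encode p))) = 0)"
    by (rule continuous_on_coordinatewise_then_product, rule continuous_on_finitely_determined)
      (metis finite.emptyI finite.insertI insertI1)
  moreover have "continuous_on UNIV (\<lambda>(w :: nat \<Rightarrow> nat) k. snd (prod_decode (w k)))"
    by (rule continuous_on_coordinatewise_then_product, rule continuous_on_finitely_determined)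
      (metis finite.emptyI finite.insertI insertI1)
  ultimately show ?thesis
    unfolding dec_def by (rule continuous_on_Pair)
qed

text \<open>
  The offset \<open>c\<close> will be the number of minima below \<open>m\<close>, which are fixed on \<open>[m, B]\<close>.
\<close>

definition coded_pairs ::
  "nat \<Rightarrow> ((nat \<times> nat \<Rightarrow> bool) \<times> (nat \<Rightarrow> nat)) set \<Rightarrow> ((nat \<Rightarrow> nat) \<times> (nat \<Rightarrow> nat)) set" where
  "coded_pairs c C =
    {(x, w). dec w \<in> C \<and> x = (\<lambda>k. enumerate (mins (fst (dec w))) (k + c))}"

text \<open>Given a prescription, the minima of \<open>B\<close> are thinned to those below
  \<open>m\<close> and the range of a sparse sequence \<open>h\<close>. A member of the projection
  in the resulting cube has as minima from \<open>m\<close> on a subsequence of \<open>h\<close>,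
  which obeys the prescription.\<close>

lemma not_null_imp_positive:
  assumes X: "fst ` C \<subseteq> E_infty" and null: "fst ` C \<notin> I_infty"
  obtains U c where "U \<le> cofinite" "U \<noteq> bot"
    "\<And>P. eventually P U \<or> eventually (\<lambda>n. \<not> P n) U" "positive U (coded_pairs c C) [] []"
proof -
  obtain B m0 where B: "B \<in> E_infty" and meets0: "\<And>B'. B' \<in> cube m0 B \<Longrightarrow> cube m0 B' \<inter> fst ` C \<noteq> {}"
    using X null unfolding I_infty_def by blast
  obtain m where m: "0 < m" and meets: "\<And>B'. B' \<in> cube m B \<Longrightarrow> cube m B' \<inter> fst ` C \<noteq> {}"
  proof (cases "m0 = 0")
    case True
    then show thesis
      using that[of 1] meets0 cube_0[OF B] cube_0 by (metis cube_iff[OF B] zero_less_one)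
  next
    case False
    then show thesis using that meets0 by blast
  qed
  have inf: "infinite (mins B)" using B by (simp add: E_infty_iff)
  have "inf cofinite (principal (mins B)) \<noteq> bot"
    using inf by (simp add: trivial_limit_def eventually_inf_principal eventually_cofinite)
  then obtain U where U: "U \<le> inf cofinite (principal (mins B))" "U \<noteq> bot"
    and ultra: "\<And>P. eventually P U \<or> eventually (\<lambda>n. \<not> P n) U"
    using ex_ultrafilter_le by metis
  have U_cof: "U \<le> cofinite" and "U \<le> principal (mins B)" using U(1) by simp_all
  then have U_mins: "eventually (\<lambda>n. n \<in> mins B) U"
    by (simp add: le_principal)
  have U_ge: "eventually (\<lambda>n. m \<le> n) U"
    using eventually_ge_at_top[of m] U_cof unfolding cofinite_eq_sequentially le_filter_def by blast
  define c where "c = card (mins B \<inter> {..<m})"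
  have "positive U (coded_pairs c C) [] []"
    unfolding positive_def
  proof (intro allI impI)
    fix \<phi> assume "strategy U \<phi>"
    \<comment> \<open>The added demands make the values of \<open>h\<close> minima of
      \<open>B\<close> not below \<open>m\<close>, as the thinning requires.\<close>
    then have "strategy U (\<lambda>t n. \<phi> t n \<and> n \<in> mins B \<and> m \<le> n)"
      using U_mins U_ge by (simp add: strategy_def eventually_conj_iff)
    then obtain h where h: "strict_mono h" "\<And>k t. set t \<subseteq> h ` {..<k} \<Longrightarrow> length t \<le> k \<Longrightarrow>
        \<phi> t (h k) \<and> h k \<in> mins B \<and> m \<le> h k"
      by (rule strategy_imp_sparse_sequence[OF U(2) U_cof]) blast
    have h_mins: "h k \<in> mins B" "m \<le> h k" for k using h(2)[of "[]" k] by auto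
    define K where "K = (mins B \<inter> {..<m}) \<union> range h"
    have "infinite (range h)" using h(1) by (simp add: range_inj_infinite strict_mono_imp_inj_on)
    then obtain B' where B': "B' \<in> cube m B" "mins B' \<subseteq> K"
      using ex_cube_mins_subset[OF B m, of K] h_mins by (auto simp: K_def)
    then have B'E: "B' \<in> E_infty" using B by (simp add: cube_iff)
    obtain A y where A: "A \<in> cube m B'" "(A, y) \<in> C"
      using meets[OF B'(1)] by force
    then have infA: "infinite (mins A)" using B'E by (simp add: cube_iff E_infty_iff)
    have minsA: "mins A \<subseteq> K" "mins A \<inter> {..<m} = mins B \<inter> {..<m}"
      using mins_cube[OF B'E A(1)] mins_cube[OF B B'(1)] B'(2) by auto
    define x where "x k = enumerate (mins A) (k + c)" for k
    \<comment> \<open>Exactly \<open>c\<close> minima of \<open>A\<close> lie below \<open>m\<close>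
      and \<open>enumerate\<close> counts from 0, so the indices from \<open>c\<close> on belong to
      minima at or above \<open>m\<close>.\<close>
    have x_ge: "m \<le> x k" for k
    proof (rule ccontr)
      assume less: "\<not> m \<le> x k"
      have x: "x k \<in> mins A" "card (mins A \<inter> {..<x k}) = k + c"
        using enumerate_eq_iff[OF infA, of "k + c" "x k"] by (simp_all add: x_def)
      have "mins A \<inter> {..<x k} \<subseteq> mins A \<inter> {..<m}" using less by (auto simp only: not_le)
      moreover have "x k \<in> mins A \<inter> {..<m}" "x k \<notin> mins A \<inter> {..<x k}"
        using less x(1) by simp_all
      ultimately have "mins A \<inter> {..<x k} \<subset> mins A \<inter> {..<m}" by blast
      then have "card (mins A \<inter> {..<x k}) < c"
        unfolding c_def minsA(2)[symmetric] by (intro psubset_card_mono) auto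
      with x(2) show False by simp
    qed
    have "\<exists>l. x k = h l" for k
      using minsA(1) enumerate_in_set[OF infA, of "k + c"] x_ge[of k] by (auto simp: K_def x_def)
    then obtain g where g: "\<And>k. x k = h (g k)" by metis
    have "strict_mono g"
    proof (rule strict_monoI)
      fix i j :: nat assume "i < j"
      then have "x i < x j" using infA by (simp add: x_def)
      then show "g i < g j" using h(1) by (simp add: g strict_mono_less)
    qed
    have "\<phi> (hist x n) (x n)" for n
    proof -
      have "set (hist x n) \<subseteq> h ` {..<g n}"
        using \<open>strict_mono g\<close> by (auto simp: set_hist g strict_mono_less)
      moreover have "length (hist x n) \<le> g n"
        using strict_mono_imp_increasing[OF \<open>strict_mono g\<close>] by simp
      ultimately show ?thesis using h(2) by (simp add: g)
    qed
    moreover obtain w where "dec w = (A, y)" using surj_dec by blast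
    ultimately have "(x, w) \<in> coded_pairs c C" "obeys \<phi> 0 x"
      using A(2) by (auto simp: coded_pairs_def x_def obeys_def)
    then show "\<exists>(x, w)\<in>coded_pairs c C. hist x (length []) = [] \<and> hist w (length []) = [] \<and>
        obeys \<phi> (length []) x"
      by auto
  qed
  then show thesis using that U_cof U(2) ultra by blast
qed

section \<open>The equivalence relation\<close>

lemma borel_reducible_trans:
  assumes "borel_reducible X E Y F" "borel_reducible Y F Z G"
  shows "borel_reducible X E Z G"
proof -
  obtain f where f: "f \<in> restrict_space borel X \<rightarrow>\<^sub>M restrict_space borel Y"
    "\<And>x x'. x \<in> X \<Longrightarrow> x' \<in> X \<Longrightarrow> (x, x') \<in> E \<longleftrightarrow> (f x, f x') \<in> F"
    using assms(1) unfolding borel_reducible_def by blast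
  obtain g where g: "g \<in> restrict_space borel Y \<rightarrow>\<^sub>M restrict_space borel Z"
    "\<And>y y'. y \<in> Y \<Longrightarrow> y' \<in> Y \<Longrightarrow> (y, y') \<in> F \<longleftrightarrow> (g y, g y') \<in> G"
    using assms(2) unfolding borel_reducible_def by blast
  have fY: "f x \<in> Y" if "x \<in> X" for x
    using measurable_space[OF f(1), of x] that by (simp add: space_restrict_space)
  have "(x, x') \<in> E \<longleftrightarrow> (g (f x), g (f x')) \<in> G" if "x \<in> X" "x' \<in> X" for x x'
    using f(2)[OF that] g(2)[OF fY[OF that(1)] fY[OF that(2)]] by simp
  then show ?thesis
    unfolding borel_reducible_def by (intro bexI[OF _ measurable_compose[OF f(1) g(1)]]) blast
qed

lemma borel_reducible_Restr:
  assumes "Y \<subseteq> X"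
  shows "borel_reducible Y (Restr F Y) X F"
  unfolding borel_reducible_def
proof (rule bexI[of _ "\<lambda>x. x"])
  show "(\<lambda>x. x) \<in> restrict_space borel Y \<rightarrow>\<^sub>M restrict_space borel X"
    using assms by (intro measurable_restrict_space2 measurable_restrict_space1)
      (auto simp: space_restrict_space)
qed auto

lemma E1_iff: "(x, y) \<in> E1 \<longleftrightarrow> (\<exists>n0. \<forall>n\<ge>n0. \<forall>m. x (n, m) = y (n, m))"
proof -
  have "(\<forall>n m. x (k + n, m) = y (k + n, m)) \<longleftrightarrow> (\<forall>n\<ge>k. \<forall>m. x (n, m) = y (n, m))" for k
    by (metis le_add1 le_Suc_ex)
  then show ?thesis by (simp add: E1_def)
qed

text \<open>\<open>E1\<close> compares columns of bits, so column \<open>n\<close> stores the graph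
  of the map from \<open>l\<close> to the minimum with index
  \<open>prod_encode (n, l)\<close>.\<close>

definition posn :: "(nat \<times> nat \<Rightarrow> bool) \<Rightarrow> nat \<times> nat \<Rightarrow> bool" where
  "posn A = (\<lambda>(n, j). case prod_decode j of (l, v) \<Rightarrow>
    enumerate (mins A) (prod_encode (n, l)) = v)"

definition F_infty :: "(nat \<times> nat \<Rightarrow> bool) rel" where
  "F_infty = {(A, A'). A \<in> E_infty \<and> A' \<in> E_infty \<and> (posn A, posn A') \<in> E1}"

lemma posn_E1_iff:
  "(posn A, posn A') \<in> E1 \<longleftrightarrow> (\<exists>n0. \<forall>n\<ge>n0. \<forall>l.
    enumerate (mins A) (prod_encode (n, l)) = enumerate (mins A') (prod_encode (n, l)))"
proof -
  have "(\<forall>m. posn A (n, m) = posn A' (n, m)) \<longleftrightarrow>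
    (\<forall>l. enumerate (mins A) (prod_encode (n, l)) = enumerate (mins A') (prod_encode (n, l)))"
    (is "?L \<longleftrightarrow> ?R") for n
  proof
    assume L: ?L
    show ?R
    proof
      fix l
      show "enumerate (mins A) (prod_encode (n, l)) = enumerate (mins A') (prod_encode (n, l))"
        using L[rule_format, of "prod_encode (l, enumerate (mins A) (prod_encode (n, l)))"]
        by (simp add: posn_def)
    qed
  qed (simp add: posn_def)
  then show ?thesis unfolding E1_iff by simp
qed

lemma equiv_F_infty: "equiv E_infty F_infty"
proof (rule equivI)
  have E1: "(x, x) \<in> E1" "(x, y) \<in> E1 \<Longrightarrow> (y, x) \<in> E1"
    "(x, y) \<in> E1 \<Longrightarrow> (y, z) \<in> E1 \<Longrightarrow> (x, z) \<in> E1" for x y z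
  proof -
    assume "(x, y) \<in> E1" "(y, z) \<in> E1"
    then obtain k l where "\<forall>n\<ge>k. \<forall>m. x (n, m) = y (n, m)" "\<forall>n\<ge>l. \<forall>m. y (n, m) = z (n, m)"
      unfolding E1_iff by blast
    then show "(x, z) \<in> E1" unfolding E1_iff by (intro exI[of _ "max k l"]) simp
  qed (auto simp: E1_iff)
  show "F_infty \<subseteq> E_infty \<times> E_infty" by (auto simp: F_infty_def)
  show "refl_on E_infty F_infty" by (rule refl_onI) (simp add: F_infty_def E1(1))
  show "sym F_infty" by (rule symI) (simp add: F_infty_def, blast intro: E1(2))
  show "trans F_infty" by (rule transI) (simp add: F_infty_def, blast intro: E1(3))
qed

section \<open>Borel measurability of the space, the cubes and the relation\<close>

lemma pred_coordinate: "Measurable.pred borel (\<lambda>A :: 'a \<Rightarrow> bool. A p)"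
proof -
  have "open ((\<lambda>A :: 'a \<Rightarrow> bool. A p) -` {True})"
    by (intro open_vimage) (auto simp: open_discrete)
  then show ?thesis by (simp add: pred_def vimage_def)
qed

lemma pred_mins [measurable]: "Measurable.pred borel (\<lambda>A. k \<in> mins A)"
proof -
  note pred_coordinate [measurable]
  show ?thesis unfolding mins_def by measurable
qed

lemma E_infty_borel [measurable]: "E_infty \<in> sets borel"
proof -
  note pred_coordinate [measurable]
  have "Measurable.pred borel (\<lambda>A. A \<in> E_infty)"
    unfolding E_infty_iff equiv_Collect_iff infinite_nat_iff_unbounded_le by measurable
  then show ?thesis by (simp add: pred_def)
qed

lemma cube_borel:
  assumes "B \<in> E_infty"
  shows "cube m B \<in> sets borel"
proof -
  note pred_coordinate [measurable]
  have "Measurable.pred borel (\<lambda>A. A \<in> E_infty)" by (simp add: pred_def)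
  then have "Measurable.pred borel (\<lambda>A. A \<in> cube m B)"
    unfolding cube_iff[OF assms] by measurable
  then show ?thesis by (simp add: pred_def)
qed

lemma measurable_enumerate_mins:
  "(\<lambda>A. enumerate (mins A) i) \<in> restrict_space borel E_infty \<rightarrow>\<^sub>M count_space UNIV"
proof -
  have pred [measurable]: "Measurable.pred (restrict_space borel E_infty) (\<lambda>A. k \<in> mins A)" for k
    by (rule measurable_restrict_space1) (rule pred_mins)
  show ?thesis
  proof (induction i)
    case 0
    show ?case unfolding enumerate_0 by measurable
  next
    case (Suc i)
    note Suc.IH [measurable]
    have "(\<lambda>A. LEAST s. s \<in> mins A \<and> enumerate (mins A) i < s)
        \<in> restrict_space borel E_infty \<rightarrow>\<^sub>M count_space UNIV"
      by measurable
    \<comment> \<open>As there are infinitely many minima on \<open>E_infty\<close>, the next one is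
      the least above the current one.\<close>
    then show ?case
      by (rule measurable_cong[THEN iffD1, rotated])
        (simp add: space_restrict_space E_infty_iff enumerate_Suc'')
  qed
qed

lemma measurable_posn: "posn \<in> restrict_space borel E_infty \<rightarrow>\<^sub>M borel"
proof (rule measurable_coordinatewise_then_product)
  fix p :: "nat \<times> nat"
  obtain n j where p: "p = (n, j)" by fastforce
  obtain l v where j: "prod_decode j = (l, v)" by fastforce
  note measurable_enumerate_mins [measurable]
  have "Measurable.pred (restrict_space borel E_infty)
      (\<lambda>A. enumerate (mins A) (prod_encode (n, l)) = v)"
    by measurable
  then have "(\<lambda>A. posn A p) \<in> restrict_space borel E_infty \<rightarrow>\<^sub>M count_space UNIV"
    by (simp add: posn_def p j)
  then show "(\<lambda>A. posn A p) \<in> restrict_space borel E_infty \<rightarrow>\<^sub>M borel"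
    by (rule measurable_compose) simp
qed

lemma F_infty_borel: "F_infty \<in> sets (restrict_space borel (E_infty \<times> E_infty))"
proof -
  let ?M = "restrict_space borel (E_infty \<times> E_infty)"
  have fst: "fst \<in> ?M \<rightarrow>\<^sub>M restrict_space borel E_infty"
    by (intro measurable_restrict_space2 measurable_restrict_space1 borel_measurable_continuous_onI
        continuous_on_fst continuous_on_id) (auto simp: space_restrict_space)
  have snd: "snd \<in> ?M \<rightarrow>\<^sub>M restrict_space borel E_infty"
    by (intro measurable_restrict_space2 measurable_restrict_space1 borel_measurable_continuous_onI
        continuous_on_snd continuous_on_id) (auto simp: space_restrict_space)
  \<comment> \<open>Equality of two functions into the naturals is split over the countably many
    common values.\<close>
  have eq: "Measurable.pred ?M (\<lambda>p. f p = g p)"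
    if [measurable]: "f \<in> ?M \<rightarrow>\<^sub>M count_space UNIV" "g \<in> ?M \<rightarrow>\<^sub>M count_space UNIV"
    for f g :: "_ \<Rightarrow> nat"
  proof -
    have "Measurable.pred ?M (\<lambda>p. \<exists>v. g p = v \<and> f p = v)" by measurable
    then show ?thesis by simp
  qed
  have "Measurable.pred ?M (\<lambda>p. \<exists>n0. \<forall>n. n0 \<le> n \<longrightarrow> (\<forall>l. enumerate (mins (fst p)) (prod_encode (n, l)) =
      enumerate (mins (snd p)) (prod_encode (n, l))))"
    by (intro pred_intros_countable pred_intros_logic eq
        measurable_compose[OF fst measurable_enumerate_mins]
        measurable_compose[OF snd measurable_enumerate_mins]) simp
  then have "{p \<in> space ?M. \<exists>n0. \<forall>n\<ge>n0. \<forall>l. enumerate (mins (fst p)) (prod_encode (n, l)) =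
      enumerate (mins (snd p)) (prod_encode (n, l))} \<in> sets ?M"
    by (simp only: pred_def)
  moreover have "F_infty = {p \<in> space ?M. \<exists>n0. \<forall>n\<ge>n0. \<forall>l.
      enumerate (mins (fst p)) (prod_encode (n, l)) = enumerate (mins (snd p)) (prod_encode (n, l))}"
    unfolding F_infty_def posn_E1_iff by (simp add: set_eq_iff space_restrict_space conj_assoc)
  ultimately show ?thesis by simp
qed

text \<open>A Borel set is the projection of its product with the Baire space.\<close>

lemma analytic_F_infty: "analytic_set F_infty"
  unfolding analytic_set_def
proof (rule bexI)
  have "E_infty \<times> E_infty \<in> sets borel"
    using E_infty_borel by (intro borel_Times)
  then have "F_infty \<in> sets borel"
    using F_infty_borel sets_restrict_space_iff[of "E_infty \<times> E_infty" borel F_infty] by simp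
  moreover have "fst \<in> (borel :: (((nat \<times> nat \<Rightarrow> bool) \<times> (nat \<times> nat \<Rightarrow> bool)) \<times> (nat \<Rightarrow> nat)) measure)
      \<rightarrow>\<^sub>M borel"
    by (intro borel_measurable_continuous_onI continuous_on_fst continuous_on_id)
  ultimately have "fst -` F_infty \<inter> space borel
      \<in> sets (borel :: (((nat \<times> nat \<Rightarrow> bool) \<times> (nat \<times> nat \<Rightarrow> bool)) \<times> (nat \<Rightarrow> nat)) measure)"
    by (rule measurable_sets[rotated])
  then show "F_infty \<times> (UNIV :: (nat \<Rightarrow> nat) set) \<in> sets borel"
    by (simp add: fst_vimage_eq_Times)
qed simp

section \<open>Reductions to and from \<open>E1\<close>\<close>

lemma F_infty_reducible_E1: "borel_reducible E_infty F_infty UNIV E1"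
  unfolding borel_reducible_def
proof (rule bexI[of _ posn])
  show "posn \<in> restrict_space borel E_infty \<rightarrow>\<^sub>M restrict_space borel UNIV"
    using measurable_posn by (simp add: measurable_restrict_space2)
qed (auto simp: F_infty_def)

lemma E1_reducible_F_infty:
  assumes X: "X \<in> sets borel" "X \<subseteq> E_infty" "X \<notin> I_infty"
  shows "borel_reducible UNIV E1 X (Restr F_infty X)"
proof -
  obtain C :: "((nat \<times> nat \<Rightarrow> bool) \<times> (nat \<Rightarrow> nat)) set" where C: "closed C" "X = fst ` C"
    using X(1) by (rule borel_imp_projection_closed)
  obtain U c where U: "U \<le> cofinite" "U \<noteq> bot"
    and ultra: "\<And>P. eventually P U \<or> eventually (\<lambda>n. \<not> P n) U"
    and pos: "positive U (coded_pairs c C) [] []"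
    using not_null_imp_positive[of C] X C(2) by blast
  obtain \<phi> W where strat: "strategy U \<phi>"
    and approx: "\<And>x n. obeys \<phi> 0 x \<Longrightarrow>
      \<exists>(x', w')\<in>coded_pairs c C. hist x' n = hist x n \<and> hist w' n = hist (W x) n"
    and cont: "\<And>x j. obeys \<phi> 0 x \<Longrightarrow> \<exists>k. \<forall>y. hist y k = hist x k \<longrightarrow> W y j = W x j"
    by (rule positive_imp_continuous_witness[OF ultra pos]) blast
  obtain h where h: "strict_mono h"
    "\<And>k t. set t \<subseteq> h ` {..<k} \<Longrightarrow> length t \<le> k \<Longrightarrow> \<phi> t (h k)"
    using strategy_imp_sparse_sequence[OF U(2,1) strat] by blast
  \<comment> \<open>Entry \<open>k\<close> is meant to be the minimum with index
    \<open>k + c\<close>, lying in column \<open>n\<close> at row \<open>l\<close>. The shift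
    \<open>l - c\<close> makes row \<open>m + c\<close> carry the bit \<open>z (n, m)\<close>, so no
    bit is lost to the \<open>c\<close> fixed minima; rows below \<open>c\<close> repeat the bit
    \<open>z (n, 0)\<close>.\<close>
  define \<xi> :: "(nat \<times> nat \<Rightarrow> bool) \<Rightarrow> nat \<Rightarrow> nat" where
    "\<xi> z k = (case prod_decode (k + c) of (n, l) \<Rightarrow> if z (n, l - c) then h (2 * k) else h (2 * k + 1))"
    for z k
  have \<xi>_cases: "\<xi> z k = h (2 * k) \<or> \<xi> z k = h (2 * k + 1)" for z k
    by (simp add: \<xi>_def split: prod.split)
  \<comment> \<open>Entries before stage \<open>n\<close> come from indices below
    \<open>2 * n\<close>, so both candidates for stage \<open>n\<close> are admissible whatever the
    earlier choices were.\<close>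
  have obeys: "obeys \<phi> 0 (\<xi> z)" for z
    unfolding obeys_def
  proof (intro allI impI)
    fix n
    have sub: "\<xi> z i \<in> h ` {..<2 * n}" if "i < n" for i
      using \<xi>_cases[of z i] that by auto
    then have "set (hist (\<xi> z) n) \<subseteq> h ` {..<2 * n}" "set (hist (\<xi> z) n) \<subseteq> h ` {..<2 * n + 1}"
      by (fastforce simp: set_hist)+
    then show "\<phi> (hist (\<xi> z) n) (\<xi> z n)"
      using \<xi>_cases[of z n] h(2)[of "hist (\<xi> z) n" "2 * n"] h(2)[of "hist (\<xi> z) n" "2 * n + 1"] by auto
  qed
  define A where "A z = fst (dec (W (\<xi> z)))" for z
  have A_X: "A z \<in> X" for z
  proof -
    \<comment> \<open>Codes of approximating pairs lie in this closed set, hence so does their limit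
      \<open>W (\<xi> z)\<close>.\<close>
    have "closed (dec -` C)" using C(1) continuous_on_dec by (rule closed_vimage)
    moreover have "\<exists>w'\<in>dec -` C. hist w' n = hist (W (\<xi> z)) n" for n
      using approx[OF obeys[of z], of n] unfolding coded_pairs_def by blast
    ultimately have "dec (W (\<xi> z)) \<in> C" using closed_hist_closure by blast
    then show ?thesis unfolding A_def C(2) by (rule imageI)
  qed
  have A_enum: "enumerate (mins (A z)) (k + c) = \<xi> z k" for z k
  proof -
    define v where "v = \<xi> z k"
    \<comment> \<open>An approximation up to \<open>N\<close> has the correct entry \<open>k\<close>
      and agrees with \<open>A z\<close> on all pairs up to \<open>v\<close>. By
      \<open>enumerate_eq_iff\<close> this determines the index of \<open>v\<close> in
      \<open>A z\<close>.\<close>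
    have "finite (insert k (prod_encode ` ({..v} \<times> {..v})))" by simp
    then obtain N where "\<forall>i\<in>insert k (prod_encode ` ({..v} \<times> {..v})). i < N"
      using finite_nat_set_iff_bounded by blast
    then have N: "k < N" "\<And>i j. i \<le> v \<Longrightarrow> j \<le> v \<Longrightarrow> prod_encode (i, j) < N" by auto
    obtain x' w' where Z: "(x', w') \<in> coded_pairs c C" "hist x' N = hist (\<xi> z) N"
      "hist w' N = hist (W (\<xi> z)) N"
      using approx[OF obeys[of z], of N] by blast
    define A' where "A' = fst (dec w')"
    have "A' \<in> X" using Z(1) by (auto simp: A'_def C(2) coded_pairs_def)
    then have inf: "infinite (mins A')" "infinite (mins (A z))"
      using X(2) A_X[of z] by (auto simp: E_infty_iff)
    have "enumerate (mins A') (k + c) = v"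
      using Z(1,2) N(1) by (auto simp: coded_pairs_def A'_def v_def hist_eq_iff)
    then have v: "v \<in> mins A'" "card (mins A' \<inter> {..<v}) = k + c"
      using enumerate_eq_iff[OF inf(1)] by simp_all
    have "A' (i, j) = A z (i, j)" if "i \<le> v" "j \<le> v" for i j
      using Z(3) N(2)[OF that] by (simp add: A'_def A_def dec_def hist_eq_iff)
    then have mem: "i \<in> mins A' \<longleftrightarrow> i \<in> mins (A z)" if "i \<le> v" for i
      using that by (auto simp: mins_def)
    then have "mins A' \<inter> {..<v} = mins (A z) \<inter> {..<v}" by auto
    then show ?thesis
      using v mem[of v] enumerate_eq_iff[OF inf(2)] by (simp flip: v_def)
  qed
  have "continuous_on UNIV A"
  proof (rule continuous_on_coordinatewise_then_product, rule continuous_on_finitely_determined)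
    fix p :: "nat \<times> nat" and z
    obtain k where k: "\<And>y. hist y k = hist (\<xi> z) k \<Longrightarrow> W y (prod_encode p) = W (\<xi> z) (prod_encode p)"
      using cont[OF obeys] by blast
    \<comment> \<open>The bits of \<open>z\<close> consulted by the first \<open>k\<close> entries
      of \<open>\<xi> z\<close>, which already decide the value of \<open>A z\<close> at
      \<open>p\<close>.\<close>
    define J where "J = (\<lambda>i. case prod_decode (i + c) of (n, l) \<Rightarrow> (n, l - c)) ` {..<k}"
    have "A z' p = A z p" if "\<forall>j\<in>J. z' j = z j" for z'
    proof -
      have "\<xi> z' i = \<xi> z i" if "i < k" for i
      proof -
        obtain n l where nl: "prod_decode (i + c) = (n, l)" by fastforce
        then have "(n, l - c) \<in> J" using that by (force simp: J_def)
        then show ?thesis using \<open>\<forall>j\<in>J. z' j = z j\<close> by (simp add: \<xi>_def nl)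
      qed
      then have "W (\<xi> z') (prod_encode p) = W (\<xi> z) (prod_encode p)"
        by (intro k) (simp add: hist_eq_iff)
      then show ?thesis by (simp add: A_def dec_def)
    qed
    moreover have "finite J" by (simp add: J_def)
    ultimately show "\<exists>J. finite J \<and> (\<forall>z'. (\<forall>j\<in>J. z' j = z j) \<longrightarrow> A z' p = A z p)"
      by blast
  qed
  then have "A \<in> restrict_space borel UNIV \<rightarrow>\<^sub>M restrict_space borel X"
    using A_X by (intro measurable_restrict_space2 measurable_restrict_space1
        borel_measurable_continuous_onI) auto
  moreover have "(z, z') \<in> E1 \<longleftrightarrow> (A z, A z') \<in> Restr F_infty X" for z z'
  proof -
    have enum: "enumerate (mins (A z)) (prod_encode (n, l)) =
      (if z (n, l - c) then h (2 * (prod_encode (n, l) - c)) else h (2 * (prod_encode (n, l) - c) + 1))"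
      if "c \<le> prod_encode (n, l)" for z n l
      using A_enum[of z "prod_encode (n, l) - c"] that by (simp add: \<xi>_def)
    have h_neq: "h (2 * i) \<noteq> h (2 * i + 1)" for i
      using h(1) by (simp add: strict_mono_eq)
    have "(z, z') \<in> E1 \<longleftrightarrow> (posn (A z), posn (A z')) \<in> E1"
    proof
      assume "(z, z') \<in> E1"
      then obtain n0 where n0: "\<And>n m. n \<ge> n0 \<Longrightarrow> z (n, m) = z' (n, m)" unfolding E1_iff by blast
      \<comment> \<open>Columns from \<open>c\<close> on contain only indices at least
        \<open>c\<close>, hence none of the fixed minima.\<close>
      have "enumerate (mins (A z)) (prod_encode (n, l)) = enumerate (mins (A z')) (prod_encode (n, l))"
        if "n \<ge> max n0 c" for n l
      proof -
        have "c \<le> prod_encode (n, l)" using le_prod_encode_1[of n l] that by simp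
        then show ?thesis using n0[of n "l - c"] that by (simp add: enum)
      qed
      then show "(posn (A z), posn (A z')) \<in> E1" unfolding posn_E1_iff by blast
    next
      assume "(posn (A z), posn (A z')) \<in> E1"
      then obtain n0 where n0: "\<And>n l. n \<ge> n0 \<Longrightarrow> enumerate (mins (A z)) (prod_encode (n, l)) =
          enumerate (mins (A z')) (prod_encode (n, l))" unfolding posn_E1_iff by blast
      \<comment> \<open>The bit is read back at row \<open>m + c\<close>, whose index is at least
        \<open>c\<close>; the two candidate values differ by \<open>h_neq\<close>.\<close>
      have "z (n, m) = z' (n, m)" if "n \<ge> n0" for n m
      proof -
        have "c \<le> prod_encode (n, m + c)" using le_prod_encode_2[of "m + c" n] by simp
        then show ?thesis
          using n0[OF that, of "m + c"] h_neq[of "prod_encode (n, m + c) - c"]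
          by (simp add: enum split: if_splits)
      qed
      then show "(z, z') \<in> E1" unfolding E1_iff by blast
    qed
    then show ?thesis using A_X X(2) by (auto simp: F_infty_def)
  qed
  ultimately show ?thesis unfolding borel_reducible_def by blast
qed

text \<open>The three relations reduce to one another in a circle: inclusion of \<open>X\<close> in
  \<open>E_infty\<close>, then \<open>posn\<close> into \<open>E1\<close>, then the map from
  \<open>E1\<close> back into \<open>X\<close>.\<close>

lemma bireducible_F_infty:
  assumes "X \<in> sets borel" "X \<subseteq> E_infty" "X \<notin> I_infty"
  shows "borel_bireducible X (Restr F_infty X) UNIV E1" "borel_bireducible E_infty F_infty X (Restr F_infty X)"
proof -
  note E1 = E1_reducible_F_infty[OF assms]
  note Restr = borel_reducible_Restr[OF assms(2), of F_infty]
  show "borel_bireducible X (Restr F_infty X) UNIV E1"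
    using borel_reducible_trans[OF Restr F_infty_reducible_E1] E1 by (simp only: borel_bireducible_def)
  show "borel_bireducible E_infty F_infty X (Restr F_infty X)"
    using borel_reducible_trans[OF F_infty_reducible_E1 E1] Restr by (simp only: borel_bireducible_def)
qed

text \<open>Any candidate \<open>B'\<close> lies itself in both \<open>cube m B'\<close> and
  \<open>cube m B\<close>.\<close>

lemma cube_not_null:
  assumes "B \<in> E_infty"
  shows "cube m B \<notin> I_infty"
proof
  assume "cube m B \<in> I_infty"
  then obtain B' where B': "B' \<in> cube m B" "cube m B' \<inter> cube m B = {}"
    using assms unfolding I_infty_def by blast
  moreover have "B' \<in> E_infty" using B'(1) by (simp add: cube_def)
  ultimately show False using cube_refl by blast
qed

theorem proposition1p1:
  shows "in_spectrum_up_to_bireducibility E_infty I_infty UNIV E1 \<and>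
    (\<exists>F. borel_equiv E_infty F \<and>
      (\<forall>m. \<forall>B \<in> E_infty. borel_bireducible (cube m B) (Restr F (cube m B)) UNIV E1))"
proof -
  \<comment> \<open>Equality provides a member of \<open>E_infty\<close>; a cube below it carries
    the reduction of \<open>E1\<close> to \<open>F_infty\<close> on the whole space.\<close>
  have "mins (\<lambda>(i, j). i = j) = UNIV" by (auto simp: mins_def)
  then have id: "(\<lambda>(i, j). i = j) \<in> E_infty"
    by (simp add: E_infty_iff equiv_Collect_iff)
  have sub: "cube m B \<subseteq> E_infty" for m B by (auto simp: cube_def)
  have cube: "borel_bireducible (cube m B) (Restr F_infty (cube m B)) UNIV E1" if "B \<in> E_infty" for m B
    using bireducible_F_infty(1)[OF cube_borel[OF that] sub cube_not_null[OF that]] .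
  have "borel_bireducible E_infty F_infty UNIV E1"
    using cube[OF id, of 0] F_infty_reducible_E1 borel_reducible_Restr[OF sub] borel_reducible_trans
    unfolding borel_bireducible_def by blast
  moreover have "in_spectrum E_infty I_infty F_infty"
    unfolding in_spectrum_def
  proof (intro conjI ballI impI)
    fix B assume B: "B \<in> sets (restrict_space borel E_infty)" "B \<notin> I_infty"
    then have "B \<in> sets borel" "B \<subseteq> E_infty"
      using E_infty_borel by (auto simp: sets_restrict_space)
    \<comment> \<open>Every Borel set outside the ideal already serves as its own
      \<open>C\<close>.\<close>
    then show "\<exists>C\<in>sets (restrict_space borel E_infty). C \<subseteq> B \<and> C \<notin> I_infty \<and>
        borel_bireducible E_infty F_infty C (Restr F_infty C)"
      using bireducible_F_infty(2) B by blast
  qed (simp_all add: equiv_F_infty analytic_F_infty)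
  moreover have "borel_equiv E_infty F_infty"
    by (simp add: borel_equiv_def equiv_F_infty F_infty_borel)
  ultimately show ?thesis
    unfolding in_spectrum_up_to_bireducibility_def using cube by blast
qed

end
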